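(* Let $d\ge2$, let $A$ be an invertible real $d\times d$ matrix, and let $\eta:[0,\infty)\to\mathbb{R}$ be a $C^2$ function whose derivative $\eta'$ is everywhere non-vanishing. For $q\in\mathbb{R}^d$ set $\varphi_q^{A,\eta}(x)=\eta\big(|A(x-q)|^2\big)$, $x\in\mathbb{R}^d$. Let $\mathcal{Q}=\{q^{(1)},\ldots,q^{(d)}\}\subseteq\mathbb{R}^d$ be an affinely independent set of $d$ points. Then the family $$\mathsf{\Phi}_{\mathcal{Q}}^{A,\eta}=\big\{\varphi_{q^{(1)}}^{A,\eta},\ldots,\varphi_{q^{(d)}}^{A,\eta}\big\}$$ is admissible on $\mathbb{R}^d$. More precisely, the associated critical set is $\Sigma_{\mathcal{Q}}^{A,\eta}=\operatorname{Aff}(\mathcal{Q})$ (the affine span of $\mathcal{Q}$), and, at each of these critical points, the corresponding encoding map is fold non-degenerate.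
   Context: $|\cdot|$ is the Euclidean norm. For a family $\{\varphi_1,\ldots,\varphi_d\}$ of $C^2$ functions on $\mathbb{R}^d$, the encoding map is $\mathsf{H}=(\varphi_1,\ldots,\varphi_d)$, the critical set is $\Sigma=\{x\in\mathbb{R}^d:\operatorname{rank}D_x\mathsf{H}(x)\le d-1\}$, and $J=\det D_x\mathsf{H}$. The family is admissible if there is a $C^1$ embedded $(d-1)$-dimensional submanifold $M\subset\mathbb{R}^d$ (possibly empty) with $\Sigma\subseteq M$ and $\operatorname{rank}(D_x\mathsf{H}(x)|_{T_xM})=d-1$ for every $x\in M$. The encoding map is fold non-degenerate at $x\in\Sigma$ if $\operatorname{rank}D_x\mathsf{H}(x)=d-1$ and $D_xJ(x)[v]\neq0$ for every $v\in\ker D_x\mathsf{H}(x)\setminus\{0\}$. *)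

theory Defs
  imports "HOL-Analysis.Analysis"
begin

text \<open>
  Continuous differentiability on a set. Derivatives are taken within the set, so that the same
  notion serves for open sets and for the half-line \<open>{0..}\<close> (one-sided derivatives at 0).
\<close>

definition C1_on :: "'a::real_normed_vector set \<Rightarrow> ('a \<Rightarrow> 'b::real_normed_vector) \<Rightarrow> bool" where
  "C1_on S f \<longleftrightarrow>
    (\<exists>f' :: 'a \<Rightarrow> 'a \<Rightarrow>\<^sub>L 'b.
      (\<forall>x\<in>S. (f has_derivative blinfun_apply (f' x)) (at x within S)) \<and> continuous_on S f')"

definition C2_on :: "'a::real_normed_vector set \<Rightarrow> ('a \<Rightarrow> 'b::real_normed_vector) \<Rightarrow> bool" where
  "C2_on S f \<longleftrightarrow>
    (\<exists>f' :: 'a \<Rightarrow> 'a \<Rightarrow>\<^sub>L 'b.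
      (\<forall>x\<in>S. (f has_derivative blinfun_apply (f' x)) (at x within S)) \<and> C1_on S f')"

text \<open>
  Embedded submanifolds by slice charts: near each of its points, \<open>M\<close> is straightened to a piece of
  a \<open>k\<close>-dimensional linear subspace by a \<open>C\<^sup>1\<close> diffeomorphism between open sets of the ambient
  space. The empty set is a submanifold of every dimension.
\<close>

definition C1_embedded_submanifold :: "nat \<Rightarrow> 'a::euclidean_space set \<Rightarrow> bool" where
  "C1_embedded_submanifold k M \<longleftrightarrow>
    (\<forall>p\<in>M. \<exists>U V L (f :: 'a \<Rightarrow> 'a) g.
      open U \<and> p \<in> U \<and> open V \<and> homeomorphism U V f g \<and> C1_on U f \<and> C1_on V g \<and>
      subspace L \<and> dim L = k \<and> f ` (U \<inter> M) = V \<inter> L)"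

text \<open>The tangent space \<open>T\<^sub>xM\<close>: velocities at \<open>x\<close> of \<open>C\<^sup>1\<close> curves in \<open>M\<close>.\<close>

definition tangent_space :: "'a::euclidean_space set \<Rightarrow> 'a \<Rightarrow> 'a set" where
  "tangent_space M x =
    {v. \<exists>(c :: real \<Rightarrow> 'a) e. e > 0 \<and> C1_on {-e<..<e} c \<and> c ` {-e<..<e} \<subseteq> M \<and> c 0 = x \<and>
        (c has_vector_derivative v) (at 0)}"

text \<open>
  A family of \<open>d\<close> functions on \<open>\<real>\<^sup>d\<close> is indexed by the same finite type as the coordinates, with
  \<open>d = CARD('d)\<close>.
\<close>

definition encoding_map :: "('d::finite \<Rightarrow> real^'d \<Rightarrow> real) \<Rightarrow> real^'d \<Rightarrow> real^'d" where
  "encoding_map \<phi> x = (\<chi> i. \<phi> i x)"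

definition critical_set :: "('d::finite \<Rightarrow> real^'d \<Rightarrow> real) \<Rightarrow> (real^'d) set" where
  "critical_set \<phi> = {x. rank (jacobian (encoding_map \<phi>) (at x)) \<le> CARD('d) - 1}"

definition jacobian_det :: "('d::finite \<Rightarrow> real^'d \<Rightarrow> real) \<Rightarrow> real^'d \<Rightarrow> real" where
  "jacobian_det \<phi> x = det (jacobian (encoding_map \<phi>) (at x))"

text \<open>
  The rank of the restriction of the differential to \<open>T\<^sub>xM\<close> is the dimension of the image of
  \<open>T\<^sub>xM\<close>. The standing assumption that the functions are \<open>C\<^sup>2\<close> is part of admissibility.
\<close>

definition admissible :: "('d::finite \<Rightarrow> real^'d \<Rightarrow> real) \<Rightarrow> bool" where
  "admissible \<phi> \<longleftrightarrow>
    (\<forall>i. C2_on UNIV (\<phi> i)) \<and>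
    (\<exists>M. C1_embedded_submanifold (CARD('d) - 1) M \<and> critical_set \<phi> \<subseteq> M \<and>
      (\<forall>x\<in>M. dim (frechet_derivative (encoding_map \<phi>) (at x) ` tangent_space M x)
               = CARD('d) - 1))"

text \<open>
  For \<open>C\<^sup>2\<close> families \<open>jacobian_det \<phi>\<close> is differentiable; asking for the existence of its derivative
  only excludes the arbitrary value that \<^const>\<open>frechet_derivative\<close> takes otherwise.
\<close>

definition fold_nondegenerate_at :: "('d::finite \<Rightarrow> real^'d \<Rightarrow> real) \<Rightarrow> real^'d \<Rightarrow> bool" where
  "fold_nondegenerate_at \<phi> x \<longleftrightarrow>
    rank (jacobian (encoding_map \<phi>) (at x)) = CARD('d) - 1 \<and>
    (\<exists>J'. (jacobian_det \<phi> has_derivative J') (at x) \<and>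
      (\<forall>v. frechet_derivative (encoding_map \<phi>) (at x) v = 0 \<and> v \<noteq> 0 \<longrightarrow> J' v \<noteq> 0))"

definition radial_fn ::
  "real^'d^'d \<Rightarrow> (real \<Rightarrow> real) \<Rightarrow> real^'d \<Rightarrow> real^('d::finite) \<Rightarrow> real" where
  "radial_fn A \<eta> q x = \<eta> ((norm (A *v (x - q)))\<^sup>2)"

end

theory Submission
  imports Defs
begin

text \<open>
  Writing \<open>R x\<close> for the matrix with rows \<open>q i - x\<close>, the differential of the encoding map at \<open>x\<close> is
  \<open>K x ** R x ** (transpose A ** A)\<close> with an invertible diagonal matrix \<open>K x\<close>, so its rank is that
  of \<open>R x\<close>, namely the affine dimension of the points \<open>q i\<close> together with \<open>x\<close>. Hence the critical
  set is the affine hull \<open>H\<close> of the points. A kernel vector \<open>v\<close> of the differential at \<open>x \<in> H\<close> that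
  is parallel to \<open>H\<close> satisfies \<open>(A *v v) \<bullet> (A *v v) = 0\<close>, so \<open>v = 0\<close>; thus the differential is
  injective on the tangent space of \<open>H\<close>. Finally \<open>det (R x)\<close> is an affine function of \<open>x\<close> with
  zero set \<open>H\<close>, so the derivative of the Jacobian determinant at a point of \<open>H\<close> vanishes only in
  directions parallel to \<open>H\<close>, which contain no nonzero kernel vector.
\<close>

section \<open>Continuously differentiable functions\<close>

text \<open>In finite dimension, operator-norm continuity of the derivative follows from continuity
  in each fixed direction.\<close>

lemma C1_onI:
  fixes f :: "'a::euclidean_space \<Rightarrow> 'b::real_normed_vector"
  assumes deriv: "\<And>x. x \<in> S \<Longrightarrow> (f has_derivative F x) (at x within S)"
    and cont: "\<And>v. continuous_on S (\<lambda>x. F x v)"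
  shows "C1_on S f"
proof -
  have F: "blinfun_apply (Blinfun (F x)) = F x" if "x \<in> S" for x
    using deriv[OF that] by (simp add: bounded_linear_Blinfun_apply has_derivative_bounded_linear)
  have "continuous_on S (\<lambda>x. blinfun_apply (Blinfun (F x)) i)" for i
    using cont[of i] by (rule continuous_on_eq) (simp add: F)
  then have "continuous_on S (\<lambda>x. Blinfun (F x))"
    by (intro continuous_on_blinfun_componentwise)
  then show ?thesis
    unfolding C1_on_def using F deriv by (intro exI[of _ "\<lambda>x. Blinfun (F x)"]) auto
qed

text \<open>Evaluating the operator-valued derivatives at 1 gives scalar ones. Non-triviality of the
  filter makes derivatives within \<open>S\<close> unique, which ties the given \<open>f'\<close> to
  the witness hidden in \<open>C2_on\<close>.\<close>

lemma C2_on_has_real_second_derivative: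
  fixes f f' :: "real \<Rightarrow> real"
  assumes "C2_on S f"
    and f': "\<And>t. t \<in> S \<Longrightarrow> (f has_real_derivative f' t) (at t within S)"
    and nontriv: "\<And>t. t \<in> S \<Longrightarrow> at t within S \<noteq> bot"
  obtains f'' where "\<And>t. t \<in> S \<Longrightarrow> (f' has_real_derivative f'' t) (at t within S)"
    and "continuous_on S f''"
proof -
  obtain F :: "real \<Rightarrow> real \<Rightarrow>\<^sub>L real" where
    F: "\<And>t. t \<in> S \<Longrightarrow> (f has_derivative F t) (at t within S)" and "C1_on S F"
    using assms(1) unfolding C2_on_def by blast
  then obtain F' :: "real \<Rightarrow> real \<Rightarrow>\<^sub>L real \<Rightarrow>\<^sub>L real" where
    F': "\<And>t. t \<in> S \<Longrightarrow> (F has_derivative F' t) (at t within S)" and cont: "continuous_on S F'"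
    unfolding C1_on_def by blast
  have has_real: "(g has_real_derivative G 1) (at t within S)"
    if "(g has_derivative G) (at t within S)" for g :: "real \<Rightarrow> real" and G t
  proof -
    interpret bounded_linear G using that by (rule has_derivative_bounded_linear)
    have "G x = G 1 * x" for x
      using scaleR[of x 1] by simp
    then have "G = (*) (G 1)" by blast
    then show ?thesis using that by (simp add: has_field_derivative_def)
  qed
  have f'_eq: "f' t = F t 1" if "t \<in> S" for t
    using vector_derivative_unique_within[OF nontriv[OF that]] f'[OF that] has_real[OF F[OF that]]
    by (simp add: has_real_derivative_iff_has_vector_derivative)
  show thesis
  proof
    fix t assume t: "t \<in> S"
    have "((\<lambda>t. F t 1) has_derivative (\<lambda>h. F' t h 1)) (at t within S)"
      using F'[OF t]
      by (rule bounded_linear.has_derivative[OF blinfun.bounded_linear_left])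
    from has_real[OF this] show "(f' has_real_derivative F' t 1 1) (at t within S)"
      by (rule has_field_derivative_transform_within[OF _ zero_less_one t]) (simp add: f'_eq)
  next
    show "continuous_on S (\<lambda>t. F' t 1 1)"
      by (intro continuous_intros cont)
  qed
qed

lemma at_within_Ici_neq_bot:
  fixes t a :: real
  assumes "t \<in> {a..}"
  shows "at t within {a..} \<noteq> bot"
proof
  assume "at t within {a..} = bot"
  moreover have "at_right t \<le> at t within {a..}"
    using assms by (intro at_le) auto
  ultimately show False
    using trivial_limit_at_right_real[of t] by (simp add: bot.extremum_unique)
qed

text \<open>The product-rule term containing the derivative of \<open>f\<close> carries the factor
  \<open>g x\<close> and vanishes. Later \<open>g\<close> is the affine factor of the Jacobian
  determinant.\<close>

lemma has_derivative_mult_of_zero: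
  fixes f g :: "'a::real_normed_vector \<Rightarrow> real"
  assumes "f differentiable (at x)" and "(g has_derivative g') (at x)" and "g x = 0"
  shows "((\<lambda>x. f x * g x) has_derivative (\<lambda>v. f x * g' v)) (at x)"
proof -
  obtain f' where "(f has_derivative f') (at x)"
    using assms(1) unfolding differentiable_def by blast
  from has_derivative_mult[OF this assms(2)] show ?thesis
    using assms(3) by simp
qed

section \<open>Affine subspaces as submanifolds\<close>

lemma C1_on_translation: "C1_on S (\<lambda>x::'a::euclidean_space. x + a)"
  by (rule C1_onI[where F = "\<lambda>x v. v"]) (auto intro!: derivative_eq_intros continuous_intros)

text \<open>A single global chart suffices: translation by \<open>- p\<close> carries the hull onto
  its direction space.\<close>

lemma C1_embedded_submanifold_affine_hull:
  fixes S :: "'a::euclidean_space set"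
  assumes "aff_dim S = int k"
  shows "C1_embedded_submanifold k (affine hull S)"
  unfolding C1_embedded_submanifold_def
proof
  fix p assume p: "p \<in> affine hull S"
  define L where "L = span ((\<lambda>x. x - p) ` S)"
  have "affine hull S = (\<lambda>x. x + p) ` L"
    using affine_hull_span_gen[OF p] by (simp add: L_def add.commute[of p])
  then have "(\<lambda>x. x + - p) ` (UNIV \<inter> affine hull S) = UNIV \<inter> L"
    by (simp add: image_image)
  moreover have "homeomorphism UNIV UNIV (\<lambda>x. x + - p) (\<lambda>x. x + p)"
    by (auto simp: homeomorphism_def intro!: continuous_intros)
  moreover have "dim L = k"
    using assms aff_dim_eq_dim_subtract[OF p] by (simp add: L_def)
  ultimately show "\<exists>U V L (f :: 'a \<Rightarrow> 'a) g.
      open U \<and> p \<in> U \<and> open V \<and> homeomorphism U V f g \<and> C1_on U f \<and> C1_on V g \<and>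
      subspace L \<and> dim L = k \<and> f ` (U \<inter> affine hull S) = V \<inter> L"
    using C1_on_translation[of UNIV p] C1_on_translation[of UNIV "- p"] subspace_span
    by (intro exI[of _ UNIV] exI[of _ L] exI[of _ "\<lambda>x. x + - p"] exI[of _ "\<lambda>x. x + p"])
      (auto simp: L_def)
qed

text \<open>Straight lines serve as the curves. The inclusion later bounds the rank on the tangent
  space from below.\<close>

lemma span_subset_tangent_space_affine_hull:
  fixes S :: "'a::euclidean_space set"
  assumes x: "x \<in> affine hull S"
  shows "span ((\<lambda>y. y - x) ` S) \<subseteq> tangent_space (affine hull S) x"
proof
  fix v assume v: "v \<in> span ((\<lambda>y. y - x) ` S)"
  have "x + t *\<^sub>R v \<in> affine hull S" for t
    using affine_hull_span_gen[OF x] span_scale[OF v, of t] by auto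
  moreover have "C1_on {-1<..<1} (\<lambda>t. x + t *\<^sub>R v)"
    by (rule C1_onI[where F = "\<lambda>t h. h *\<^sub>R v"])
      (auto intro!: derivative_eq_intros continuous_intros)
  moreover have "((\<lambda>t. x + t *\<^sub>R v) has_vector_derivative v) (at 0)"
    by (auto intro!: derivative_eq_intros)
  ultimately show "v \<in> tangent_space (affine hull S) x"
    unfolding tangent_space_def
    by (intro CollectI exI[of _ "\<lambda>t. x + t *\<^sub>R v"] exI[of _ 1]) auto
qed

section \<open>The matrix of differences\<close>

text \<open>A product has at most the rank of its right factor; this is applied to \<open>P\<close>
  and again to its inverse.\<close>

lemma rank_mult_invertible_left:
  fixes P :: "real^'n^'n" and B :: "real^'m^'n"
  assumes "invertible P"
  shows "rank (P ** B) = rank B"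
proof -
  obtain P' where "P' ** P = mat 1"
    using assms unfolding invertible_def by blast
  then have "rank B = rank (P' ** (P ** B))"
    by (simp add: matrix_mul_assoc)
  then show ?thesis
    by (metis antisym rank_mul_le_right)
qed

lemma rank_mult_invertible_right:
  fixes P :: "real^'n^'n" and B :: "real^'n^'m"
  assumes "invertible P"
  shows "rank (B ** P) = rank B"
proof -
  have "rank (transpose P ** transpose B) = rank (transpose B)"
    by (rule rank_mult_invertible_left) (rule transpose_invertible[OF assms])
  then show ?thesis
    by (simp add: rank_transpose flip: matrix_transpose_mul)
qed

text \<open>Translating by \<open>- x\<close> turns affine dimension into row rank; \<open>x\<close>
  itself becomes 0, which does not enlarge the span.\<close>

lemma rank_difference_rows:
  fixes q :: "'m::finite \<Rightarrow> real^'n"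
  shows "int (rank (\<chi> i. q i - x)) = aff_dim (insert x (range q))"
proof -
  have "rows (\<chi> i. q i - x) = (\<lambda>y. y - x) ` range q"
    by (auto simp: rows_def row_def simp del: vector_minus_component)
  then have "rank (\<chi> i. q i - x) = dim (insert 0 ((\<lambda>y. y - x) ` range q))"
    by (metis row_rank_def dim_span span_insert_0)
  also have "insert 0 ((\<lambda>y. y - x) ` range q) = (\<lambda>y. y - x) ` insert x (range q)"
    by simp
  finally show ?thesis
    using aff_dim_eq_dim_subtract[of x "insert x (range q)"] by (simp add: hull_inc)
qed

lemma det_subtract_row_from_others:
  fixes B :: "'a::comm_ring_1^'n^'n"
  shows "det (\<chi> i. if i = k then B $ i else B $ i - B $ k) = det B"
proof -
  \<comment> \<open>\<open>S\<close> collects the rows already reduced; as \<open>k\<close> stays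
    outside, row \<open>k\<close> remains intact for the next row operation.\<close>
  have "det (\<chi> i. if i \<in> S then B $ i - B $ k else B $ i) = det B" if "finite S" "k \<notin> S" for S
    using that
  proof (induction S rule: finite_induct)
    case empty
    then show ?case by (simp add: vec_lambda_eta)
  next
    case (insert j S)
    define C where "C = (\<chi> i. if i \<in> S then B $ i - B $ k else B $ i)"
    have "j \<noteq> k" using insert by auto
    have "(\<chi> i. if i \<in> insert j S then B $ i - B $ k else B $ i)
        = (\<chi> i. if i = j then row j C + (-1) *s row k C else row i C)"
      using insert by (auto simp: vec_eq_iff C_def row_def)
    then have "det (\<chi> i. if i \<in> insert j S then B $ i - B $ k else B $ i) = det C"
      by (simp only: det_row_operation[OF \<open>j \<noteq> k\<close>])
    then show ?case using insert by (simp add: C_def)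
  qed
  from this[of "- {k}"] have "det (\<chi> i. if i \<noteq> k then B $ i - B $ k else B $ i) = det B"
    by simp
  moreover have "(\<chi> i. if i \<noteq> k then B $ i - B $ k else B $ i)
      = (\<chi> i. if i = k then B $ i else B $ i - B $ k)"
    by (simp add: vec_eq_iff)
  ultimately show ?thesis by simp
qed

text \<open>Subtracting one row from the others shows that the determinant of the difference matrix is an
  affine function of \<open>x\<close>.\<close>

lemma det_difference_rows_affine:
  fixes q :: "'n::finite \<Rightarrow> real^'n"
  obtains L where "linear L" and "\<And>x. det (\<chi> i. q i - x) = L (x - q k)"
proof
  \<comment> \<open>After the subtraction \<open>x\<close> survives only in row \<open>k\<close>,
    which is \<open>q k - x\<close>; hence linearity in that row, and the minus sign.\<close>
  define M where "M y = (\<chi> i. if i = k then y else q i - q k)" for y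
  show "linear (\<lambda>y. - det (M y))"
    by (rule linearI) (simp_all add: M_def det_row_add det_row_mul flip: scalar_mult_eq_scaleR)
  show "det (\<chi> i. q i - x) = - det (M (x - q k))" for x
  proof -
    have "det (\<chi> i. q i - x) = det (M (- 1 *s (x - q k)))"
      using det_subtract_row_from_others[of k "\<chi> i. q i - x"]
      by (simp add: M_def algebra_simps cong: if_cong)
    then show ?thesis
      by (simp only: M_def det_row_mul)
  qed
qed

section \<open>The derivative of the encoding map\<close>

text \<open>The function \<open>h\<close> is arbitrary because both \<eta> and its derivative are
  substituted for it.\<close>

lemma has_derivative_radial_fn:
  fixes A :: "real^'d^('d::finite)"
  assumes "(h has_real_derivative c) (at ((norm (A *v (x - q)))\<^sup>2) within {0..})"
  shows "(radial_fn A h q has_derivative (\<lambda>v. 2 * c * ((A *v (x - q)) \<bullet> (A *v v)))) (at x)"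
proof -
  have A: "((\<lambda>x. A *v (x - q)) has_derivative (\<lambda>v. A *v v)) (at x)"
    by (auto intro!: derivative_eq_intros
        bounded_linear.has_derivative[OF matrix_vector_mul_bounded_linear])
  have "((\<lambda>x. (norm (A *v (x - q)))\<^sup>2) has_derivative
      (\<lambda>v. 2 * ((A *v (x - q)) \<bullet> (A *v v)))) (at x)"
    unfolding power2_norm_eq_inner
    by (rule has_derivative_eq_rhs[OF has_derivative_inner[OF A A]]) (simp add: inner_commute)
  \<comment> \<open>At \<open>A *v (x - q) = 0\<close> only a one-sided derivative of
    \<open>h\<close> is available. The chain rule asks for it within the range of the squared norm,
    which lies in \<open>{0..}\<close>.\<close>
  moreover have "(h has_derivative (*) c)
      (at ((norm (A *v (x - q)))\<^sup>2) within range (\<lambda>x. (norm (A *v (x - q)))\<^sup>2))"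
    using assms unfolding has_field_derivative_def by (rule has_derivative_subset) auto
  ultimately have "((\<lambda>x. h ((norm (A *v (x - q)))\<^sup>2)) has_derivative
      (\<lambda>v. c * (2 * ((A *v (x - q)) \<bullet> (A *v v))))) (at x)"
    by (rule has_derivative_in_compose)
  then show ?thesis
    unfolding radial_fn_def[abs_def] by (simp only: mult_ac)
qed

lemma continuous_on_radial_fn:
  fixes A :: "real^'d^('d::finite)"
  assumes "continuous_on {0..} h"
  shows "continuous_on UNIV (radial_fn A h q)"
  unfolding radial_fn_def[abs_def]
  by (rule continuous_on_compose2[OF assms])
    (auto intro!: continuous_intros
      bounded_linear.continuous_on[OF matrix_vector_mul_bounded_linear])

lemma C2_on_radial_fn:
  fixes A :: "real^'d^('d::finite)"
  assumes "C2_on {0..} \<eta>"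
    and \<eta>': "\<And>t. t \<ge> 0 \<Longrightarrow> (\<eta> has_real_derivative \<eta>' t) (at t within {0..})"
  shows "C2_on UNIV (radial_fn A \<eta> q)"
proof -
  obtain \<eta>'' where \<eta>'': "\<And>t. t \<ge> 0 \<Longrightarrow> (\<eta>' has_real_derivative \<eta>'' t) (at t within {0..})"
    and cont: "continuous_on {0..} \<eta>''"
    using C2_on_has_real_second_derivative[OF assms(1) _ at_within_Ici_neq_bot] \<eta>'
    by (metis atLeast_iff)
  have cont': "continuous_on {0..} \<eta>'"
    using \<eta>'' by (auto intro!: DERIV_continuous_on)
  \<comment> \<open>\<open>g y\<close> is the inner product with \<open>y\<close> in the metric of
    \<open>transpose A ** A\<close>, as a bounded functional depending linearly on
    \<open>y\<close>.\<close>
  define g where "g y = blinfun_inner_left ((A *v y) v* A)" for y :: "real^'d"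
  have g_apply: "g y v = (A *v y) \<bullet> (A *v v)" for y v
    by (simp add: g_def dot_lmul_matrix inner_commute[of v])
  have g: "bounded_linear g"
    unfolding g_def transpose_matrix_vector[symmetric]
    by (intro bounded_linear_compose[OF bounded_linear_blinfun_inner_left]
        bounded_linear_compose[OF matrix_vector_mul_bounded_linear]
        matrix_vector_mul_bounded_linear)
  have first: "(radial_fn A \<eta> q has_derivative
      blinfun_apply ((2 * radial_fn A \<eta>' q x) *\<^sub>R g (x - q))) (at x)" for x
    using has_derivative_radial_fn[OF \<eta>']
    by (simp add: scaleR_blinfun.rep_eq g_apply radial_fn_def)
  have g': "((\<lambda>x. g (x - q)) has_derivative g) (at x)" for x
    by (rule bounded_linear.has_derivative[OF g]) (auto intro!: derivative_eq_intros)
  have "((\<lambda>x. (2 * radial_fn A \<eta>' q x) *\<^sub>R g (x - q)) has_derivative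
      (\<lambda>v. (2 * radial_fn A \<eta>' q x) *\<^sub>R g v +
        (2 * (2 * radial_fn A \<eta>'' q x * ((A *v (x - q)) \<bullet> (A *v v)))) *\<^sub>R g (x - q))) (at x)" for x
    using has_derivative_radial_fn[OF \<eta>'']
    by (intro has_derivative_scaleR g' has_derivative_mult_right) (simp add: radial_fn_def[abs_def])
  moreover have "continuous_on UNIV (\<lambda>x. (2 * radial_fn A \<eta>' q x) *\<^sub>R g v +
        (2 * (2 * radial_fn A \<eta>'' q x * ((A *v (x - q)) \<bullet> (A *v v)))) *\<^sub>R g (x - q))" for v
    by (intro continuous_intros continuous_on_radial_fn cont cont' bounded_linear.continuous_on[OF g]
        bounded_linear.continuous_on[OF matrix_vector_mul_bounded_linear])
  ultimately have "C1_on UNIV (\<lambda>x. (2 * radial_fn A \<eta>' q x) *\<^sub>R g (x - q))"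
    by (intro C1_onI) auto
  then show ?thesis
    unfolding C2_on_def using first
    by (intro exI[of _ "\<lambda>x. (2 * radial_fn A \<eta>' q x) *\<^sub>R g (x - q)"]) simp
qed

text \<open>This is the diagonal matrix \<open>K x\<close>; its sign compensates for the rows
  \<open>q i - x\<close> replacing \<open>x - q i\<close>.\<close>

definition radial_weights ::
  "real^'d^'d \<Rightarrow> (real \<Rightarrow> real) \<Rightarrow> ('d \<Rightarrow> real^'d) \<Rightarrow> real^'d \<Rightarrow> real^'d^('d::finite)" where
  "radial_weights A \<eta>' q x = (\<chi> i j. if i = j then - 2 * radial_fn A \<eta>' (q i) x else 0)"

definition radial_jacobian ::
  "real^'d^'d \<Rightarrow> (real \<Rightarrow> real) \<Rightarrow> ('d \<Rightarrow> real^'d) \<Rightarrow> real^'d \<Rightarrow> real^'d^('d::finite)" where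
  "radial_jacobian A \<eta>' q x =
    radial_weights A \<eta>' q x ** (\<chi> i. q i - x) ** (transpose A ** A)"

lemma det_radial_weights:
  "det (radial_weights A \<eta>' q x) = (\<Prod>i\<in>UNIV. - 2 * radial_fn A \<eta>' (q i) x)"
  unfolding radial_weights_def by (subst det_diagonal) auto

text \<open>Matches the factored matrix, row by row, with the derivative computed for
  \<open>radial_fn\<close>.\<close>

lemma radial_jacobian_mult_component:
  "(radial_jacobian A \<eta>' q x *v v) $ i =
    2 * radial_fn A \<eta>' (q i) x * ((A *v (x - q i)) \<bullet> (A *v v))"
proof -
  have diag: "(radial_weights A \<eta>' q x *v y) $ i = - 2 * radial_fn A \<eta>' (q i) x * y $ i" for y
    by (simp add: radial_weights_def matrix_vector_mult_def if_distrib[of "\<lambda>c. c * _"] cong: if_cong)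
  have "((\<chi> i. q i - x) *v (transpose A *v (A *v v))) $ i = (q i - x) \<bullet> (transpose A *v (A *v v))"
    by (simp add: matrix_vector_mul_component)
  also have "\<dots> = (A *v v) \<bullet> (A *v (q i - x))"
    by (simp add: inner_commute[of "q i - x"] dot_lmul_matrix)
  also have "\<dots> = - ((A *v (x - q i)) \<bullet> (A *v v))"
    by (simp add: matrix_vector_mult_diff_distrib inner_diff_left inner_diff_right inner_commute)
  finally show ?thesis
    by (simp add: radial_jacobian_def diag flip: matrix_vector_mul_assoc)
qed

lemma has_derivative_encoding_map_radial:
  fixes A :: "real^'d^('d::finite)"
  assumes "\<And>t. t \<ge> 0 \<Longrightarrow> (\<eta> has_real_derivative \<eta>' t) (at t within {0..})"
  shows "(encoding_map (\<lambda>i. radial_fn A \<eta> (q i)) has_derivative (*v) (radial_jacobian A \<eta>' q x)) (at x)"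
proof -
  have "((\<lambda>x. encoding_map (\<lambda>i. radial_fn A \<eta> (q i)) x \<bullet> b) has_derivative
      (\<lambda>v. (radial_jacobian A \<eta>' q x *v v) \<bullet> b)) (at x)" if b: "b \<in> Basis" for b
  proof -
    obtain i where "b = axis i 1"
      using axis_inverse[OF b] by blast
    then show ?thesis
      using has_derivative_radial_fn[OF assms, of A x "q i"]
      by (simp add: inner_axis encoding_map_def radial_jacobian_mult_component radial_fn_def[abs_def])
  qed
  then show ?thesis
    using has_derivative_componentwise_within[where S = UNIV] by blast
qed

section \<open>Critical set, fold non-degeneracy and admissibility\<close>

theorem proposition5p1:
  fixes A :: "real^'d^('d::finite)"
    and \<eta> \<eta>' :: "real \<Rightarrow> real"
    and q :: "'d \<Rightarrow> real^'d"
  assumes "CARD('d) \<ge> 2"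
    and "invertible A"
    and "C2_on {0..} \<eta>"
    and "\<And>t. t \<ge> 0 \<Longrightarrow> (\<eta> has_real_derivative \<eta>' t) (at t within {0..})"
    and "\<And>t. t \<ge> 0 \<Longrightarrow> \<eta>' t \<noteq> 0"
    and "inj q"
    and "\<not> affine_dependent (range q)"
  defines "\<Phi> \<equiv> (\<lambda>i. radial_fn A \<eta> (q i))"
  shows "admissible \<Phi> \<and>
         critical_set \<Phi> = affine hull (range q) \<and>
         (\<forall>x\<in>critical_set \<Phi>. fold_nondegenerate_at \<Phi> x)"
proof -
  define D where "D = radial_jacobian A \<eta>' q"
  define Q where "Q = range q"
  note \<eta>' = assms(4) and \<eta>'_nz = assms(5)
  have deriv: "(encoding_map \<Phi> has_derivative (*v) (D x)) (at x)" for x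
    unfolding \<Phi>_def D_def by (rule has_derivative_encoding_map_radial[OF \<eta>'])
  have frechet: "frechet_derivative (encoding_map \<Phi>) (at x) = (*v) (D x)" for x
    using frechet_derivative_at[OF deriv] by simp
  then have jac: "jacobian (encoding_map \<Phi>) (at x) = D x" for x
    by (simp add: jacobian_def)

  have weight_nz: "radial_fn A \<eta>' (q i) x \<noteq> 0" for i x
    by (simp add: radial_fn_def \<eta>'_nz)
  then have weights: "invertible (radial_weights A \<eta>' q x)" for x
    by (simp add: invertible_det_nz det_radial_weights)
  have gram: "invertible (transpose A ** A)"
    using assms(2) by (simp add: invertible_mult transpose_invertible)

  have "int CARD('d) = aff_dim Q + 1"
    using aff_dim_affine_independent[OF assms(7)] card_image[OF assms(6)] by (simp add: Q_def)
  then have aff_dim_Q: "aff_dim Q = int (CARD('d) - 1)"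
    using assms(1) by simp
  \<comment> \<open>Adjoining \<open>x\<close> to \<open>Q\<close> raises the affine dimension by
    one exactly when \<open>x\<close> lies outside the hull.\<close>
  have rank_R: "rank (\<chi> i. q i - x) = (if x \<in> affine hull Q then CARD('d) - 1 else CARD('d))" for x
    using rank_difference_rows[of q x] aff_dim_insert[of x Q] aff_dim_Q assms(1)
    by (auto simp: Q_def split: if_splits)
  then have rank_D: "rank (D x) = (if x \<in> affine hull Q then CARD('d) - 1 else CARD('d))" for x
    by (simp add: D_def radial_jacobian_def rank_mult_invertible_left rank_mult_invertible_right
        weights gram)
  then have crit: "critical_set \<Phi> = affine hull Q"
    using assms(1) by (auto simp: critical_set_def jac)

  \<comment> \<open>For \<open>x\<close> in the hull, \<open>W x\<close> is its direction space; the
    generators \<open>q i - x\<close> are the rows of \<open>R x\<close>.\<close>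
  define W where "W x = span ((\<lambda>y. y - x) ` Q)" for x
  have hull: "y \<in> affine hull Q \<longleftrightarrow> y - x \<in> W x" if "x \<in> affine hull Q" for x y
    unfolding affine_hull_span_gen[OF that] W_def by (force simp: algebra_simps)
  have ker: "v = 0" if "D x *v v = 0" and v: "v \<in> W x" for x v
  proof -
    \<comment> \<open>As the weights are nonzero, the kernel equation makes \<open>A *v v\<close>
      orthogonal to the image of each generator; taking \<open>w = v\<close> then forces
      \<open>A *v v = 0\<close>.\<close>
    have "(A *v w) \<bullet> (A *v v) = 0" if "w \<in> W x" for w
      using that unfolding W_def
    proof (induction rule: span_induct_alt)
      case base
      then show ?case by simp
    next
      case (step c z w)
      then obtain i where z: "z = q i - x" by (auto simp: Q_def)
      have "(A *v (x - q i)) \<bullet> (A *v v) = 0"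
        using arg_cong[OF \<open>D x *v v = 0\<close>, of "\<lambda>u. u $ i"] weight_nz
        by (simp add: D_def radial_jacobian_mult_component)
      then have "(A *v z) \<bullet> (A *v v) = 0"
        by (simp add: z matrix_vector_mult_diff_distrib inner_diff_left)
      then show ?case
        using step by (simp add: matrix_vector_right_distrib matrix_vector_mult_scaleR inner_add_left)
    qed
    from this[OF v] have "A *v v = 0" by simp
    then show "v = 0"
      using assms(2) by (metis invertible_def matrix_left_invertible_ker)
  qed

  have fold: "fold_nondegenerate_at \<Phi> x" if x: "x \<in> affine hull Q" for x
  proof -
    fix k :: 'd
    obtain L where "linear L" and L: "\<And>x. det (\<chi> i. q i - x) = L (x - q k)"
      using det_difference_rows_affine[of q k] by blast
    \<comment> \<open>The Jacobian determinant splits into this nowhere-zero factor and the affine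
      factor vanishing exactly on the hull.\<close>
    define C where "C x = det (radial_weights A \<eta>' q x) * det (transpose A ** A)" for x
    have jac_det: "jacobian_det \<Phi> = (\<lambda>x. C x * L (x - q k))"
      by (rule ext) (simp add: jacobian_det_def jac D_def radial_jacobian_def C_def det_mul L)
    have det_eq_0: "L (y - q k) = 0 \<longleftrightarrow> y \<in> affine hull Q" for y
      using det_eq_0_rank[of "\<chi> i. q i - y"] rank_R[of y] assms(1) by (auto simp: L)
    have "((\<lambda>x. L (x - q k)) has_derivative L) (at x)"
      using \<open>linear L\<close>
      by (intro bounded_linear.has_derivative[where f = L] linear_conv_bounded_linear[THEN iffD1])
        (auto intro!: derivative_eq_intros)
    moreover have "C differentiable (at x)"
    proof -
      \<comment> \<open>\<open>C\<close> is a product of values of \<eta>', so its differentiability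
        rests on the second derivative.\<close>
      obtain \<eta>'' where \<eta>'': "\<And>t. t \<ge> 0 \<Longrightarrow> (\<eta>' has_real_derivative \<eta>'' t) (at t within {0..})"
        using C2_on_has_real_second_derivative[OF assms(3) _ at_within_Ici_neq_bot] \<eta>'
        by (metis atLeast_iff)
      have "((\<lambda>x. - 2 * radial_fn A \<eta>' (q i) x) has_derivative (\<lambda>v. - 2 *
          (2 * \<eta>'' ((norm (A *v (x - q i)))\<^sup>2) * ((A *v (x - q i)) \<bullet> (A *v v))))) (at x)" for i
        by (intro has_derivative_mult_right has_derivative_radial_fn \<eta>'') simp
      then show ?thesis
        unfolding C_def det_radial_weights
        by (rule differentiableI[OF has_derivative_mult_left[OF has_derivative_prod]])
    qed
    ultimately have deriv_J: "(jacobian_det \<Phi> has_derivative (\<lambda>v. C x * L v)) (at x)"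
      unfolding jac_det using det_eq_0 x by (intro has_derivative_mult_of_zero) auto
    have "C x * L v \<noteq> 0" if "D x *v v = 0" "v \<noteq> 0" for v
    proof
      assume "C x * L v = 0"
      moreover have "C x \<noteq> 0"
        using weights gram by (simp add: C_def invertible_det_nz)
      \<comment> \<open>\<open>L v = 0\<close> puts \<open>q k + v\<close> in the zero set of the
        affine factor, so \<open>v\<close> is parallel to the hull.\<close>
      ultimately have "q k + v \<in> affine hull Q"
        using det_eq_0[of "q k + v"] by simp
      moreover have "q k \<in> affine hull Q"
        by (simp add: Q_def hull_inc)
      ultimately have "(q k + v - x) - (q k - x) \<in> W x"
        unfolding hull[OF x] W_def by (rule span_diff)
      then show False
        using ker[OF that(1)] that(2) by simp
    qed
    then show ?thesis
      unfolding fold_nondegenerate_at_def jac frechet using rank_D x deriv_J by auto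
  qed

  have "dim ((*v) (D x) ` tangent_space (affine hull Q) x) = CARD('d) - 1"
    if x: "x \<in> affine hull Q" for x
  proof (rule antisym)
    have "dim ((*v) (D x) ` tangent_space (affine hull Q) x) \<le> dim (range ((*v) (D x)))"
      by (intro dim_subset) auto
    then show "dim ((*v) (D x) ` tangent_space (affine hull Q) x) \<le> CARD('d) - 1"
      using rank_D x by (simp flip: rank_dim_range)
    \<comment> \<open>Lower bound: \<open>D x\<close> is injective on the \<open>d - 1\<close>
      dimensional space \<open>W x\<close>, which lies in the tangent space.\<close>
    have "inj_on ((*v) (D x)) (W x)"
    proof (rule inj_onI)
      fix u v assume "u \<in> W x" "v \<in> W x" "D x *v u = D x *v v"
      then have "u - v = 0"
        by - (rule ker[of x], simp_all add: W_def span_diff matrix_vector_mult_diff_distrib)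
      then show "u = v" by simp
    qed
    then have "dim ((*v) (D x) ` W x) = dim (W x)"
      by (intro dim_image_eq[OF matrix_vector_mul_linear]) (simp add: W_def span_span)
    also have "\<dots> = CARD('d) - 1"
      using aff_dim_eq_dim_subtract[OF x] aff_dim_Q by (simp add: W_def)
    finally show "CARD('d) - 1 \<le> dim ((*v) (D x) ` tangent_space (affine hull Q) x)"
      using dim_subset[OF image_mono[OF span_subset_tangent_space_affine_hull[OF x]], of "(*v) (D x)"]
      by (simp add: W_def)
  qed
  \<comment> \<open>The submanifold \<open>M\<close> is the critical set itself.\<close>
  then have "admissible \<Phi>"
    unfolding admissible_def frechet crit
    using C2_on_radial_fn[OF assms(3) \<eta>'] C1_embedded_submanifold_affine_hull[OF aff_dim_Q]
    by (auto simp: \<Phi>_def)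
  then show ?thesis
    using crit fold by (simp add: Q_def)
qed

end
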